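(* Let $N$ be a normal subgroup of a finite rank free group $F$, and let $N'=[N,N]$ be the derived subgroup of $N$. If $F/N$ is sofic, then $F/N'$ is sofic.
   Context: For a finite set $A$, the normalized Hamming distance on $\mathrm{Sym}(A)$ is $d_{\mathrm{Hamm}}(\pi,\tau)=\frac{1}{|A|}|\{a\in A:\pi(a)\neq\tau(a)\}|$, and $\ell_{\mathrm{Hamm}}(\pi)=d_{\mathrm{Hamm}}(\pi,1)$. Let $G$ be a countable discrete group, $S\subseteq G$ finite and $\varepsilon>0$. A function $\sigma\colon G\to\mathrm{Sym}(A)$ (not necessarily a homomorphism) is an $(S,\varepsilon)$-sofic approximation if $\sigma(1)=1$, $\max_{g,h\in S}d_{\mathrm{Hamm}}(\sigma(gh),\sigma(g)\sigma(h))<\varepsilon$, and $\min_{g\in S\setminus\{1\}}\ell_{\mathrm{Hamm}}(\sigma(g))>1-\varepsilon$. The group $G$ is sofic if for every finite $S\subseteq G$ and every $\varepsilon>0$ there are a finite set $A$ and an $(S,\varepsilon)$-sofic approximation $\sigma\colon G\to\mathrm{Sym}(A)$. *)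

theory Defs
  imports Complex_Main "HOL-Algebra.Generated_Groups" "HOL-Combinatorics.Permutations" "HOL-Library.Countable_Set"
begin

(* A word is a list of signed letters: (True, x) stands for x, (False, x) for its inverse. *)

definition word_eval :: "('a, 'b) monoid_scheme \<Rightarrow> ('c \<Rightarrow> 'a) \<Rightarrow> (bool \<times> 'c) list \<Rightarrow> 'a" where
  "word_eval G f w =
     foldr (\<lambda>(b, x) g. (if b then f x else inv\<^bsub>G\<^esub> f x) \<otimes>\<^bsub>G\<^esub> g) w \<one>\<^bsub>G\<^esub>"

definition reduced_words :: "'c set \<Rightarrow> (bool \<times> 'c) list set" where
  "reduced_words X = {w \<in> lists (UNIV \<times> X). successively (\<lambda>(b, x) (c, y). x = y \<longrightarrow> b = c) w}"

(* Every group element is the value of exactly one reduced word over X.  The universal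
   property is derived below, where the target group may live in any type. *)
definition free_basis :: "('a, 'b) monoid_scheme \<Rightarrow> 'a set \<Rightarrow> bool" where
  "free_basis G X \<longleftrightarrow> group G \<and> X \<subseteq> carrier G \<and>
     bij_betw (word_eval G (\<lambda>x. x)) (reduced_words X) (carrier G)"

definition finite_rank_free_group :: "('a, 'b) monoid_scheme \<Rightarrow> bool" where
  "finite_rank_free_group G \<longleftrightarrow> (\<exists>X. finite X \<and> free_basis G X)"

definition hamming_dist :: "'c set \<Rightarrow> ('c \<Rightarrow> 'c) \<Rightarrow> ('c \<Rightarrow> 'c) \<Rightarrow> real" where
  "hamming_dist A p q = real (card {a \<in> A. p a \<noteq> q a}) / real (card A)"

definition hamming_length :: "'c set \<Rightarrow> ('c \<Rightarrow> 'c) \<Rightarrow> real" where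
  "hamming_length A p = hamming_dist A p id"

(* Sym(A) consists of the functions p with p permutes A (equal to the identity off A),
   under composition.  The bounds on a maximum or minimum over S are stated pointwise,
   hence hold vacuously over an empty index set. *)
definition sofic_approximation ::
    "('a, 'b) monoid_scheme \<Rightarrow> 'a set \<Rightarrow> real \<Rightarrow> 'c set \<Rightarrow> ('a \<Rightarrow> 'c \<Rightarrow> 'c) \<Rightarrow> bool" where
  "sofic_approximation G S \<epsilon> A \<sigma> \<longleftrightarrow>
     (\<forall>g \<in> carrier G. \<sigma> g permutes A) \<and>
     \<sigma> \<one>\<^bsub>G\<^esub> = id \<and>
     (\<forall>g \<in> S. \<forall>h \<in> S. hamming_dist A (\<sigma> (g \<otimes>\<^bsub>G\<^esub> h)) (\<sigma> g \<circ> \<sigma> h) < \<epsilon>) \<and>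
     (\<forall>g \<in> S - {\<one>\<^bsub>G\<^esub>}. hamming_length A (\<sigma> g) > 1 - \<epsilon>)"

(* Taking A inside nat is no restriction: see sofic_approximation_transfer. *)
definition sofic_group :: "('a, 'b) monoid_scheme \<Rightarrow> bool" where
  "sofic_group G \<longleftrightarrow> group G \<and> countable (carrier G) \<and>
     (\<forall>S \<epsilon>. finite S \<and> S \<subseteq> carrier G \<and> 0 < \<epsilon> \<longrightarrow>
        (\<exists>(A :: nat set) \<sigma>. finite A \<and> A \<noteq> {} \<and> sofic_approximation G S \<epsilon> A \<sigma>))"

lemma sofic_approximation_transfer:
  fixes A :: "'c set" and B :: "'d set"
  assumes G: "group G" and S: "S \<subseteq> carrier G"
    and approx: "sofic_approximation G S \<epsilon> A \<sigma>" and \<phi>: "bij_betw \<phi> A B"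
  shows "\<exists>\<tau>. sofic_approximation G S \<epsilon> B \<tau>"
proof -
  define \<psi> where "\<psi> = inv_into A \<phi>"
  define T where "T p b = (if b \<in> B then \<phi> (p (\<psi> b)) else b)" for p b
  have \<psi>: "bij_betw \<psi> B A"
    unfolding \<psi>_def using \<phi> by (rule bij_betw_inv_into)
  have \<psi>A: "\<psi> b \<in> A" "\<phi> (\<psi> b) = b" if "b \<in> B" for b
    using that \<phi> \<psi> by (auto simp: \<psi>_def bij_betw_inv_into_right bij_betw_apply)
  have \<phi>B: "\<phi> a \<in> B" "\<psi> (\<phi> a) = a" if "a \<in> A" for a
    using that \<phi> by (auto simp: \<psi>_def bij_betw_inv_into_left bij_betw_apply)
  have T_permutes: "T p permutes B" if "p permutes A" for p
  proof (rule bij_imp_permutes)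
    have "bij_betw (\<phi> \<circ> (p \<circ> \<psi>)) B B"
      by (rule bij_betw_trans[OF bij_betw_trans[OF \<psi> permutes_imp_bij[OF that]] \<phi>])
    then show "bij_betw (T p) B B"
      by (subst bij_betw_cong[of B _ "\<phi> \<circ> (p \<circ> \<psi>)"]) (simp_all add: T_def)
  qed (simp add: T_def)
  have card_eq: "card A = card B"
    using \<phi> by (rule bij_betw_same_card)
  have dist: "hamming_dist B p' q' = hamming_dist A p q"
    if p: "p permutes A" and q: "q permutes A"
      and pq: "\<And>b. b \<in> B \<Longrightarrow> p' b = T p b" "\<And>b. b \<in> B \<Longrightarrow> q' b = T q b" for p q p' q'
  proof -
    have "T p (\<phi> a) \<noteq> T q (\<phi> a) \<longleftrightarrow> p a \<noteq> q a" if "a \<in> A" for a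
    proof -
      have "p a \<in> A" "q a \<in> A"
        using that permutes_in_image[OF p] permutes_in_image[OF q] by blast+
      then have "\<phi> (p a) = \<phi> (q a) \<longleftrightarrow> p a = q a"
        using \<phi>B(2) by metis
      then show ?thesis using \<phi>B[OF that] by (simp add: T_def)
    qed
    then have iff: "p' (\<phi> a) \<noteq> q' (\<phi> a) \<longleftrightarrow> p a \<noteq> q a" if "a \<in> A" for a
      using that \<phi>B(1)[OF that] pq by simp
    have "{b \<in> B. p' b \<noteq> q' b} = \<phi> ` {a \<in> A. p a \<noteq> q a}"
    proof (intro equalityI subsetI)
      fix b assume b: "b \<in> {b \<in> B. p' b \<noteq> q' b}"
      then have "\<psi> b \<in> {a \<in> A. p a \<noteq> q a}"
        using iff[of "\<psi> b"] \<psi>A[of b] by simp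
      then show "b \<in> \<phi> ` {a \<in> A. p a \<noteq> q a}"
        using b \<psi>A(2)[of b] by (intro image_eqI[where x = "\<psi> b"]) auto
    next
      fix b assume "b \<in> \<phi> ` {a \<in> A. p a \<noteq> q a}"
      then show "b \<in> {b \<in> B. p' b \<noteq> q' b}"
        using iff \<phi>B(1) by blast
    qed
    moreover have "inj_on \<phi> {a \<in> A. p a \<noteq> q a}"
      using \<phi> by (auto simp: bij_betw_def inj_on_def)
    ultimately show ?thesis
      by (simp add: hamming_dist_def card_image card_eq)
  qed
  interpret group G by (rule G)
  have perm: "\<sigma> g permutes A" if "g \<in> carrier G" for g
    using approx that by (auto simp: sofic_approximation_def)
  have "sofic_approximation G S \<epsilon> B (\<lambda>g. T (\<sigma> g))"
    unfolding sofic_approximation_def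
  proof (intro conjI ballI)
    show "T (\<sigma> g) permutes B" if "g \<in> carrier G" for g
      using that by (intro T_permutes perm)
    show "T (\<sigma> \<one>\<^bsub>G\<^esub>) = id"
      using approx \<psi>A by (auto simp: sofic_approximation_def T_def)
    show "hamming_dist B (T (\<sigma> (g \<otimes>\<^bsub>G\<^esub> h))) (T (\<sigma> g) \<circ> T (\<sigma> h)) < \<epsilon>"
      if "g \<in> S" "h \<in> S" for g h
    proof -
      have gh: "\<sigma> g permutes A" "\<sigma> h permutes A" "\<sigma> (g \<otimes>\<^bsub>G\<^esub> h) permutes A"
        using that S by (auto intro!: perm)
      have "hamming_dist B (T (\<sigma> (g \<otimes>\<^bsub>G\<^esub> h))) (T (\<sigma> g) \<circ> T (\<sigma> h)) =
            hamming_dist A (\<sigma> (g \<otimes>\<^bsub>G\<^esub> h)) (\<sigma> g \<circ> \<sigma> h)"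
        using \<psi>A \<phi>B gh permutes_in_image[OF gh(2)]
        by (intro dist permutes_compose) (auto simp: T_def)
      then show ?thesis
        using approx that by (auto simp: sofic_approximation_def)
    qed
    show "hamming_length B (T (\<sigma> g)) > 1 - \<epsilon>" if "g \<in> S - {\<one>\<^bsub>G\<^esub>}" for g
    proof -
      have "hamming_length B (T (\<sigma> g)) = hamming_length A (\<sigma> g)"
        unfolding hamming_length_def using that S \<psi>A
        by (intro dist perm permutes_id) (auto simp: T_def)
      then show ?thesis
        using approx that by (auto simp: sofic_approximation_def)
    qed
  qed
  then show ?thesis by blast
qed

lemma word_eval_Nil [simp]: "word_eval G f [] = \<one>\<^bsub>G\<^esub>"
  by (simp add: word_eval_def)

lemma word_eval_Cons [simp]:
  "word_eval G f ((b, x) # w) = (if b then f x else inv\<^bsub>G\<^esub> f x) \<otimes>\<^bsub>G\<^esub> word_eval G f w"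
  by (simp add: word_eval_def)

lemma (in group) word_eval_closed:
  assumes "f \<in> X \<rightarrow> carrier G" "w \<in> lists (UNIV \<times> X)"
  shows "word_eval G f w \<in> carrier G"
  using assms(2) by (induction w) (use assms(1) in \<open>auto simp: Pi_iff\<close>)

lemma (in group) word_eval_append:
  assumes "f \<in> X \<rightarrow> carrier G" "v \<in> lists (UNIV \<times> X)" "w \<in> lists (UNIV \<times> X)"
  shows "word_eval G f (v @ w) = word_eval G f v \<otimes> word_eval G f w"
  using assms(2)
proof (induction v)
  case (Cons l v)
  obtain b x where l: "l = (b, x)" by fastforce
  have "f x \<in> carrier G" using Cons l assms(1) by auto
  moreover have "word_eval G f v \<in> carrier G" "word_eval G f w \<in> carrier G"
    using Cons assms by (auto intro!: word_eval_closed[of f X])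
  ultimately show ?case using Cons l by (simp add: m_assoc)
qed (use assms in \<open>auto simp: word_eval_closed\<close>)

fun cancel_Cons :: "bool \<times> 'c \<Rightarrow> (bool \<times> 'c) list \<Rightarrow> (bool \<times> 'c) list" where
  "cancel_Cons (b, x) [] = [(b, x)]"
| "cancel_Cons (b, x) ((c, y) # w) = (if x = y \<and> b \<noteq> c then w else (b, x) # (c, y) # w)"

lemma cancel_Cons_reduced:
  assumes "w \<in> reduced_words X" "x \<in> X"
  shows "cancel_Cons (b, x) w \<in> reduced_words X"
  using assms by (cases "((b, x), w)" rule: cancel_Cons.cases)
    (auto simp: reduced_words_def successively_Cons split: list.splits)

lemma (in group) word_eval_cancel_Cons:
  assumes "f \<in> X \<rightarrow> carrier G" "w \<in> lists (UNIV \<times> X)" "x \<in> X"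
  shows "word_eval G f (cancel_Cons (b, x) w) = word_eval G f ((b, x) # w)"
proof (cases "((b, x), w)" rule: cancel_Cons.cases)
  case (2 b' x' c y w')
  have "word_eval G f w' \<in> carrier G" "f x \<in> carrier G"
    using assms 2 by (auto intro!: word_eval_closed[of f X])
  then show ?thesis using 2 by (auto simp flip: m_assoc)
qed simp

theorem free_basis_universal:
  assumes X: "free_basis F X" and H: "group H" and f: "f \<in> X \<rightarrow> carrier H"
  shows "\<exists>h \<in> hom F H. (\<forall>x \<in> X. h x = f x) \<and>
           (\<forall>k \<in> hom F H. (\<forall>x \<in> X. k x = f x) \<longrightarrow> (\<forall>g \<in> carrier F. k g = h g))"
proof -
  interpret F: group F using X by (simp add: free_basis_def)
  interpret H: group H by (rule H)
  let ?e = "word_eval F (\<lambda>x. x)"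
  define nf where "nf = inv_into (reduced_words X) ?e"
  define h where "h g = word_eval H f (nf g)" for g
  have incl: "(\<lambda>x. x) \<in> X \<rightarrow> carrier F" and bij: "bij_betw ?e (reduced_words X) (carrier F)"
    using X by (auto simp: free_basis_def)
  have red: "w \<in> lists (UNIV \<times> X)" if "w \<in> reduced_words X" for w
    using that by (simp add: reduced_words_def)
  have nf: "nf g \<in> reduced_words X" "?e (nf g) = g" if "g \<in> carrier F" for g
    using bij that bij_betw_apply[OF bij_betw_inv_into[OF bij]]
    by (auto simp: nf_def bij_betw_inv_into_right)
  have nf_e: "nf (?e w) = w" if "w \<in> reduced_words X" for w
    using bij that by (simp add: nf_def bij_betw_inv_into_left)
  have step: "\<exists>v \<in> reduced_words X. ?e v = ?e w \<and> word_eval H f v = word_eval H f w"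
    if "w \<in> lists (UNIV \<times> X)" for w
    using that
  proof (induction w)
    case Nil
    have "[] \<in> reduced_words X" by (simp add: reduced_words_def)
    then show ?case by blast
  next
    case (Cons l w)
    obtain b x where l: "l = (b, x)" by fastforce
    with Cons have x: "x \<in> X" by auto
    obtain v where v: "v \<in> reduced_words X" "?e v = ?e w" "word_eval H f v = word_eval H f w"
      using Cons by auto
    show ?case
    proof
      show "cancel_Cons (b, x) v \<in> reduced_words X"
        using v(1) x by (rule cancel_Cons_reduced)
      show "?e (cancel_Cons (b, x) v) = ?e (l # w) \<and>
          word_eval H f (cancel_Cons (b, x) v) = word_eval H f (l # w)"
        using F.word_eval_cancel_Cons[OF incl red[OF v(1)] x]
          H.word_eval_cancel_Cons[OF f red[OF v(1)] x] v l by simp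
    qed
  qed
  have h_e: "h (?e w) = word_eval H f w" if "w \<in> lists (UNIV \<times> X)" for w
    using step[OF that] nf_e by (metis h_def)
  have "h \<in> hom F H"
  proof (rule homI)
    show "h g \<in> carrier H" if "g \<in> carrier F" for g
      using H.word_eval_closed[OF f red[OF nf(1)[OF that]]] by (simp add: h_def)
    show "h (g \<otimes>\<^bsub>F\<^esub> k) = h g \<otimes>\<^bsub>H\<^esub> h k" if "g \<in> carrier F" "k \<in> carrier F" for g k
    proof -
      have L: "nf g \<in> lists (UNIV \<times> X)" "nf k \<in> lists (UNIV \<times> X)"
        using red[OF nf(1)] that by blast+
      then have "h (?e (nf g @ nf k)) = h g \<otimes>\<^bsub>H\<^esub> h k"
        unfolding h_def[of g] h_def[of k] by (subst h_e) (auto simp: H.word_eval_append[OF f])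
      then show ?thesis using L that by (simp add: F.word_eval_append[OF incl] nf)
    qed
  qed
  moreover have "h x = f x" if "x \<in> X" for x
    using h_e[of "[(True, x)]"] that incl f by (auto simp: Pi_iff)
  moreover have "k g = h g" if k: "k \<in> hom F H" "\<forall>x \<in> X. k x = f x" and g: "g \<in> carrier F" for k g
  proof -
    interpret k: group_hom F H k by unfold_locales (rule k(1))
    have "k (?e w) = word_eval H f w" if "w \<in> lists (UNIV \<times> X)" for w
      using that
    proof (induction w)
      case (Cons l w)
      obtain b x where l: "l = (b, x)" by fastforce
      have "x \<in> carrier F" "x \<in> X" "?e w \<in> carrier F"
        using Cons l incl by (auto intro!: F.word_eval_closed[OF incl])
      then show ?case using Cons l k(2) by simp
    qed simp
    then show ?thesis using nf[OF g] red by (metis h_def)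
  qed
  ultimately show ?thesis by blast
qed

end

theory Submission
  imports Defs "HOL-Algebra.FiniteProduct"
begin

text \<open>
  A quotient \<open>F / K\<close> of a free group of finite rank is sofic exactly when \<open>F\<close> acts on finite sets in such a way
  that, on every prescribed finite part of \<open>F\<close>, the stabilizer of almost every point agrees with
  \<open>K\<close> (\<open>stabilizer_model\<close>). Lemma \<open>stabilizer_model_of_sofic\<close> turns a sofic approximation of
  \<open>F / K\<close> into such actions: the free generators may act by any permutations, in particular by
  those that the approximation assigns to their cosets. Lemma \<open>sofic_of_stabilizer_models\<close> goes
  back by choosing coset representatives. It thus suffices to turn actions that model \<open>N\<close> into
  actions that model \<open>N'\<close>.

  An action of \<open>F\<close> on \<open>A\<close> is a graph with vertices \<open>A\<close> and an edge from \<open>a\<close> to \<open>x a\<close>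
  for each point \<open>a\<close> and each free generator \<open>x\<close>. A word read from a point is a path, and its flow
  counts with sign how often the path crosses each edge. The flow is an integer valued cocycle on the
  action (\<open>flow_cocycle_exists\<close>). In the Cayley graph of \<open>F / N\<close> the elements of \<open>N\<close> are
  closed paths, and \<open>N'\<close> consists of those whose flow vanishes: on loops at a fixed
  vertex the flow is a homomorphism to an abelian group, so it kills commutators; conversely \<open>N\<close> is
  generated by one element for each edge, obtained by closing the edge up with fixed paths to the base
  vertex, and modulo \<open>N'\<close> a closed path equals the product of these elements, each raised to the flow
  through its edge. Only finitely many vertices matter for a given element, so the same criterion
  holds at any point of \<open>A\<close> around which the graph looks like the Cayley graph far enough
  (\<open>derived_local_criterion\<close>).

  Finally the flow is built into the points. On \<open>A \<times> (\<int>/m)\<^sup>E\<close>, where \<open>E\<close> is the set of edges, let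
  \<open>g\<close> send \<open>(a, f)\<close> to \<open>(g a, f + flow of g from a)\<close>. For large \<open>m\<close>, the point \<open>(a, f)\<close> is fixed
  precisely if \<open>g\<close> fixes \<open>a\<close> with zero flow. All points over a good \<open>a\<close> are therefore good
  for \<open>N'\<close>, and the proportion of bad points does not grow (\<open>stabilizer_model_derived\<close>).
\<close>

section \<open>Permutation actions and words\<close>

definition symmetric_group :: "'c set \<Rightarrow> ('c \<Rightarrow> 'c) monoid" where
  "symmetric_group A = \<lparr>carrier = {p. p permutes A}, monoid.mult = (\<circ>), one = id\<rparr>"

lemma symmetric_group_simps [simp]:
  "carrier (symmetric_group A) = {p. p permutes A}"
  "p \<otimes>\<^bsub>symmetric_group A\<^esub> q = p \<circ> q"
  "\<one>\<^bsub>symmetric_group A\<^esub> = id"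
  by (simp_all add: symmetric_group_def)

lemma group_symmetric_group: "group (symmetric_group A)"
proof (rule groupI)
  fix p assume "p \<in> carrier (symmetric_group A)"
  then have "inv_into UNIV p permutes A" "inv_into UNIV p \<circ> p = id"
    by (auto simp: permutes_inv permutes_inv_o)
  then show "\<exists>q \<in> carrier (symmetric_group A). q \<otimes>\<^bsub>symmetric_group A\<^esub> p = \<one>\<^bsub>symmetric_group A\<^esub>"
    by auto
qed (auto intro: permutes_compose permutes_id)

locale perm_action = group F for F (structure) +
  fixes A :: "'c set" and \<phi>
  assumes act_hom: "\<phi> \<in> hom F (symmetric_group A)"
begin

lemma act_permutes: "g \<in> carrier F \<Longrightarrow> \<phi> g permutes A"
  using hom_in_carrier[OF act_hom] by simp

lemma act_in: "g \<in> carrier F \<Longrightarrow> a \<in> A \<Longrightarrow> \<phi> g a \<in> A"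
  using act_permutes permutes_in_image by metis

lemma act_mult: "g \<in> carrier F \<Longrightarrow> h \<in> carrier F \<Longrightarrow> \<phi> (g \<otimes> h) a = \<phi> g (\<phi> h a)"
  using hom_mult[OF act_hom, of g h] by simp

lemma act_one: "\<phi> \<one> a = a"
  using hom_one[OF act_hom is_group group_symmetric_group] by simp

lemma act_inv: "g \<in> carrier F \<Longrightarrow> \<phi> (inv g) (\<phi> g a) = a"
  using act_mult[of "inv g" g a] by (simp add: act_one)

lemma act_eq_iff:
  assumes "g \<in> carrier F" "h \<in> carrier F"
  shows "\<phi> g a = \<phi> h a \<longleftrightarrow> \<phi> (inv g \<otimes> h) a = a"
  using act_inv[OF assms(1), of a] act_inv[of "inv g" "\<phi> h a"] act_mult[of "inv g" h a] assms
  by auto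

end

text \<open>The vertices visited by a word that is read from its last letter to its first, starting
  at the identity.\<close>

fun path_vertices :: "('a, 'b) monoid_scheme \<Rightarrow> (bool \<times> 'a) list \<Rightarrow> 'a set" where
  "path_vertices F [] = {\<one>\<^bsub>F\<^esub>}"
| "path_vertices F (l # w) = insert (word_eval F (\<lambda>x. x) (l # w)) (path_vertices F w)"

lemma finite_path_vertices: "finite (path_vertices F w)"
  by (induction w) auto

lemma word_eval_in_path_vertices: "word_eval F (\<lambda>x. x) w \<in> path_vertices F w"
  by (cases w) auto

lemma (in group) path_vertices_closed:
  assumes "X \<subseteq> carrier G" "w \<in> lists (UNIV \<times> X)"
  shows "path_vertices G w \<subseteq> carrier G"
  using assms(2)
proof (induction w)
  case (Cons l w)
  have "(\<lambda>x. x) \<in> X \<rightarrow> carrier G" using assms(1) by auto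
  with Cons word_eval_closed[of "\<lambda>x. x" X "l # w"] show ?case by auto
qed auto

lemma free_basis_word:
  assumes "free_basis F X" "g \<in> carrier F"
  obtains w where "w \<in> lists (UNIV \<times> X)" "word_eval F (\<lambda>x. x) w = g"
proof -
  have "g \<in> word_eval F (\<lambda>x. x) ` reduced_words X"
    using assms by (simp add: free_basis_def bij_betw_def)
  then show thesis using that by (auto simp: reduced_words_def)
qed

lemma countable_free_group:
  assumes "free_basis F X" "finite X"
  shows "countable (carrier F)"
proof -
  have "countable (lists ((UNIV :: bool set) \<times> X))"
    using assms(2) by (intro countable_lists countable_finite) simp
  moreover have "carrier F \<subseteq> word_eval F (\<lambda>x. x) ` lists (UNIV \<times> X)"
    using free_basis_word[OF assms(1)] by blast
  ultimately show ?thesis by (meson countable_image countable_subset)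
qed

section \<open>Stabilizers that approximate a normal subgroup\<close>

text \<open>The parameter \<open>\<epsilon>\<close> bounds the proportion of points whose stabilizer differs from \<open>N\<close> somewhere
  on \<open>T\<close>. Unlike a sofic approximation, \<open>\<phi>\<close> is a genuine homomorphism; all the error sits in the
  stabilizers.\<close>

definition stabilizer_model ::
    "('a, 'b) monoid_scheme \<Rightarrow> 'a set \<Rightarrow> 'a set \<Rightarrow> real \<Rightarrow> 'c set \<Rightarrow> ('a \<Rightarrow> 'c \<Rightarrow> 'c) \<Rightarrow> bool" where
  "stabilizer_model F N T \<epsilon> A \<phi> \<longleftrightarrow> finite A \<and> A \<noteq> {} \<and> \<phi> \<in> hom F (symmetric_group A) \<and>
     real (card {a \<in> A. \<exists>g \<in> T. (\<phi> g a = a) \<noteq> (g \<in> N)}) < \<epsilon> * real (card A)"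

lemma card_Bex_le:
  assumes "finite S" "\<And>s. s \<in> S \<Longrightarrow> real (card {a \<in> A. P s a}) \<le> c"
  shows "real (card {a \<in> A. \<exists>s \<in> S. P s a}) \<le> real (card S) * c"
proof -
  have "{a \<in> A. \<exists>s \<in> S. P s a} = (\<Union>s \<in> S. {a \<in> A. P s a})" by auto
  then have "card {a \<in> A. \<exists>s \<in> S. P s a} \<le> (\<Sum>s \<in> S. card {a \<in> A. P s a})"
    using card_UN_le[OF assms(1)] by simp
  then have "real (card {a \<in> A. \<exists>s \<in> S. P s a}) \<le> (\<Sum>s \<in> S. real (card {a \<in> A. P s a}))"
    by (simp only: of_nat_sum[symmetric] of_nat_le_iff)
  also have "\<dots> \<le> real (card S) * c"
    using assms(2) by (rule sum_bounded_above)
  finally show ?thesis .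
qed

text \<open>Reading a word letter by letter, the homomorphic action follows the almost multiplicative \<open>\<sigma>\<close>
  as long as \<open>\<sigma>\<close> is multiplicative at \<open>a\<close>; nothing is asked of it at the other points that the
  path of \<open>a\<close> meets. An inverse letter is handled by reading its step backwards, so besides the
  vertices of the path \<open>S\<close> has to contain the cosets of the generators but not of their inverses.\<close>

lemma (in perm_action) act_word_eq:
  assumes N: "N \<lhd> F" and X: "X \<subseteq> carrier F"
    and \<sigma>: "\<And>C. C \<in> carrier (F Mod N) \<Longrightarrow> \<sigma> C permutes A" "\<sigma> N = id"
    and \<phi>X: "\<And>x. x \<in> X \<Longrightarrow> \<phi> x = \<sigma> (N #> x)"
    and mult: "\<And>C D. C \<in> S \<Longrightarrow> D \<in> S \<Longrightarrow> \<sigma> (C <#> D) a = \<sigma> C (\<sigma> D a)"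
    and w: "w \<in> lists (UNIV \<times> X)"
    and S: "\<And>v. v \<in> path_vertices F w \<Longrightarrow> N #> v \<in> S" "\<And>l. l \<in> set w \<Longrightarrow> N #> snd l \<in> S"
  shows "\<phi> (word_eval F (\<lambda>x. x) w) a = \<sigma> (N #> word_eval F (\<lambda>x. x) w) a"
  using w S
proof (induction w)
  case Nil
  interpret N: normal N F by (rule N)
  show ?case using N.subset by (simp add: act_one \<sigma>(2) coset_mult_one)
next
  case (Cons l w)
  interpret N: normal N F by (rule N)
  obtain b x where l: "l = (b, x)" by fastforce
  let ?v = "word_eval F (\<lambda>x. x) w" and ?u = "word_eval F (\<lambda>x. x) (l # w)"
  have x: "x \<in> X" "x \<in> carrier F" and v: "?v \<in> carrier F"
    using Cons.hyps l X path_vertices_closed[OF X, of w] word_eval_in_path_vertices[of F w] by auto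
  have u: "?u = (if b then x else inv x) \<otimes> ?v" using l by simp
  have uc: "?u \<in> carrier F" using u x v by simp
  have IH: "\<phi> ?v a = \<sigma> (N #> ?v) a"
    using Cons by auto
  have "N #> ?u \<in> S" using Cons.prems(1)[of ?u] by simp
  moreover have "N #> ?v \<in> S" using Cons.prems(1)[of ?v] word_eval_in_path_vertices[of F w] by simp
  moreover have "N #> x \<in> S" using Cons.prems(2)[of l] l by simp
  ultimately have m: "\<sigma> (N #> (x \<otimes> ?v)) a = \<phi> x (\<sigma> (N #> ?v) a)"
      "\<sigma> (N #> (x \<otimes> ?u)) a = \<phi> x (\<sigma> (N #> ?u) a)"
    using mult[of "N #> x" "N #> ?v"] mult[of "N #> x" "N #> ?u"] \<phi>X[OF x(1)]
      N.rcos_sum[OF x(2) v] N.rcos_sum[OF x(2) uc] by metis+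
  show ?case
  proof (cases b)
    case True
    then show ?thesis using m(1) u IH x v by (simp add: act_mult)
  next
    case False
    then have "x \<otimes> ?u = ?v" using u x v by (simp flip: m_assoc)
    then have "\<phi> x (\<phi> ?u a) = \<phi> x (\<sigma> (N #> ?u) a)"
      using m(2) IH act_mult[OF x(2) uc, of a] by simp
    then show ?thesis using act_inv[OF x(2)] by metis
  qed
qed

text \<open>A point is bad only if \<open>\<sigma>\<close> fails to be multiplicative there for one of the \<open>|S|\<^sup>2\<close> pairs from
  \<open>S\<close>, or if one of the at most \<open>|S|\<close> nontrivial elements of \<open>S\<close> fixes it.\<close>

lemma stabilizer_model_of_sofic:
  fixes F :: "('a, 'b) monoid_scheme"
  assumes X: "free_basis F X" and N: "N \<lhd> F" and sofic: "sofic_group (F Mod N)"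
    and T: "finite T" "T \<subseteq> carrier F" and "0 < \<epsilon>"
  shows "\<exists>(A :: nat set) \<phi>. stabilizer_model F N T \<epsilon> A \<phi>"
proof -
  interpret normal N F by (rule N)
  have XF: "X \<subseteq> carrier F" using X by (simp add: free_basis_def)
  have "\<forall>g \<in> T. \<exists>w. w \<in> lists (UNIV \<times> X) \<and> word_eval F (\<lambda>x. x) w = g"
    using free_basis_word[OF X] T(2) by blast
  then obtain W where W: "\<And>g. g \<in> T \<Longrightarrow> W g \<in> lists (UNIV \<times> X)"
      "\<And>g. g \<in> T \<Longrightarrow> word_eval F (\<lambda>x. x) (W g) = g"
    by metis
  define S where
    "S = (\<lambda>v. N #>\<^bsub>F\<^esub> v) ` (\<Union>g \<in> T. path_vertices F (W g) \<union> snd ` set (W g))"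
  \<comment> \<open>The summand 1 makes the final estimate strict and keeps the denominator positive when
    \<open>S\<close> is empty.\<close>
  define \<delta> where "\<delta> = \<epsilon> / (real (card S * card S) + real (card S) + 1)"
  have "path_vertices F (W g) \<union> snd ` set (W g) \<subseteq> carrier F" if "g \<in> T" for g
    using path_vertices_closed[OF XF W(1)[OF that]] W(1)[OF that] XF by auto
  then have S: "finite S" "S \<subseteq> carrier (F Mod N)"
    using T(1) by (simp add: S_def finite_path_vertices, unfold S_def carrier_FactGroup, blast)
  have "0 < \<delta>" using \<open>0 < \<epsilon>\<close> by (auto simp: \<delta>_def intro!: divide_pos_pos add_nonneg_pos)
  then obtain A :: "nat set" and \<sigma> where A: "finite A" "A \<noteq> {}"
    and \<sigma>: "sofic_approximation (F Mod N) S \<delta> A \<sigma>"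
    using sofic S unfolding sofic_group_def by blast
  have perm: "\<And>C. C \<in> carrier (F Mod N) \<Longrightarrow> \<sigma> C permutes A" and one: "\<sigma> N = id"
    using \<sigma> by (auto simp: sofic_approximation_def)
  have "(\<lambda>x. \<sigma> (N #>\<^bsub>F\<^esub> x)) \<in> X \<rightarrow> carrier (symmetric_group A)"
    using perm XF by (auto simp: carrier_FactGroup)
  then obtain \<phi> where \<phi>: "\<phi> \<in> hom F (symmetric_group A)" "\<And>x. x \<in> X \<Longrightarrow> \<phi> x = \<sigma> (N #>\<^bsub>F\<^esub> x)"
    using free_basis_universal[OF X group_symmetric_group] by metis
  interpret perm_action F A \<phi> by unfold_locales (rule \<phi>(1))
  have cA: "0 < card A" using A by (simp add: card_gt_0_iff)
  let ?M = "{a \<in> A. \<exists>p \<in> S \<times> S. \<sigma> (fst p <#>\<^bsub>F\<^esub> snd p) a \<noteq> \<sigma> (fst p) (\<sigma> (snd p) a)}"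
  let ?L = "{a \<in> A. \<exists>C \<in> S - {N}. \<sigma> C a = a}"
  have "real (card ?M) \<le> real (card (S \<times> S)) * (\<delta> * real (card A))"
  proof (rule card_Bex_le)
    fix p assume "p \<in> S \<times> S"
    then have "hamming_dist A (\<sigma> (fst p <#>\<^bsub>F\<^esub> snd p)) (\<sigma> (fst p) \<circ> \<sigma> (snd p)) < \<delta>"
      using \<sigma> by (auto simp: sofic_approximation_def)
    then show "real (card {a \<in> A. \<sigma> (fst p <#>\<^bsub>F\<^esub> snd p) a \<noteq> \<sigma> (fst p) (\<sigma> (snd p) a)})
        \<le> \<delta> * real (card A)"
      using cA by (simp add: hamming_dist_def field_simps)
  qed (use S in simp)
  moreover have "real (card ?L) \<le> real (card (S - {N})) * (\<delta> * real (card A))"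
  proof (rule card_Bex_le)
    fix C assume "C \<in> S - {N}"
    then have "hamming_length A (\<sigma> C) > 1 - \<delta>"
      using \<sigma> by (auto simp: sofic_approximation_def)
    then have *: "real (card {a \<in> A. \<sigma> C a \<noteq> a}) > (1 - \<delta>) * real (card A)"
      using cA by (simp add: hamming_dist_def hamming_length_def field_simps)
    have "card A = card ({a \<in> A. \<sigma> C a = a} \<union> {a \<in> A. \<sigma> C a \<noteq> a})"
      by (rule arg_cong[of _ _ card]) auto
    also have "\<dots> = card {a \<in> A. \<sigma> C a = a} + card {a \<in> A. \<sigma> C a \<noteq> a}"
      using A(1) by (intro card_Un_disjoint) auto
    finally show "real (card {a \<in> A. \<sigma> C a = a}) \<le> \<delta> * real (card A)"
      using * by (simp add: algebra_simps)
  qed (use S in simp)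
  moreover have "real (card (S - {N})) * (\<delta> * real (card A)) \<le> real (card S) * (\<delta> * real (card A))"
    using S(1) \<open>0 < \<delta>\<close> by (intro mult_right_mono) (auto intro: card_mono)
  ultimately have "real (card ?M + card ?L)
      \<le> (real (card S * card S) + real (card S)) * (\<delta> * real (card A))"
    by (simp add: card_cartesian_product algebra_simps)
  also have "\<dots> < (real (card S * card S) + real (card S) + 1) * (\<delta> * real (card A))"
    using cA \<open>0 < \<delta>\<close> by (intro mult_strict_right_mono) auto
  also have "\<dots> = \<epsilon> * real (card A)"
  proof -
    have "real (card S * card S) + real (card S) + 1 \<noteq> 0"
      by (metis add_nonneg_pos less_irrefl of_nat_0_le_iff add_nonneg_nonneg zero_less_one)
    then show ?thesis by (simp add: \<delta>_def)
  qed
  finally have few_bad: "real (card ?M + card ?L) < \<epsilon> * real (card A)" .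
  have "{a \<in> A. \<exists>g \<in> T. (\<phi> g a = a) \<noteq> (g \<in> N)} \<subseteq> ?M \<union> ?L"
  proof (rule subsetI, rule ccontr)
    fix a assume "a \<in> {a \<in> A. \<exists>g \<in> T. (\<phi> g a = a) \<noteq> (g \<in> N)}" and n: "a \<notin> ?M \<union> ?L"
    then obtain g where a: "a \<in> A" and g: "g \<in> T" "(\<phi> g a = a) \<noteq> (g \<in> N)" by auto
    have gF: "g \<in> carrier F" using g T by auto
    have "\<phi> (word_eval F (\<lambda>x. x) (W g)) a = \<sigma> (N #>\<^bsub>F\<^esub> word_eval F (\<lambda>x. x) (W g)) a"
    proof (rule act_word_eq[OF N XF perm one \<phi>(2) _ W(1)[OF g(1)]])
      show "\<sigma> (C <#>\<^bsub>F\<^esub> D) a = \<sigma> C (\<sigma> D a)" if "C \<in> S" "D \<in> S" for C D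
        using n a that by force
      show "N #>\<^bsub>F\<^esub> v \<in> S" if "v \<in> path_vertices F (W g)" for v
        using that g by (auto simp: S_def)
      show "N #>\<^bsub>F\<^esub> snd l \<in> S" if "l \<in> set (W g)" for l
        using that g by (force simp: S_def)
    qed
    then have eq: "\<phi> g a = \<sigma> (N #>\<^bsub>F\<^esub> g) a" using W(2)[OF g(1)] by simp
    have "N #>\<^bsub>F\<^esub> g \<in> S"
      using word_eval_in_path_vertices[of F "W g"] W(2)[OF g(1)] g by (auto simp: S_def)
    moreover have "N #>\<^bsub>F\<^esub> g = N \<longleftrightarrow> g \<in> N"
      using gF coset_join1 coset_join2 subset subgroup_axioms by metis
    ultimately have "\<sigma> (N #>\<^bsub>F\<^esub> g) a = a \<longleftrightarrow> g \<in> N"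
      using n a one by auto
    then show False using eq g(2) by simp
  qed
  then have "card {a \<in> A. \<exists>g \<in> T. (\<phi> g a = a) \<noteq> (g \<in> N)} \<le> card (?M \<union> ?L)"
    using A(1) by (intro card_mono) auto
  also have "\<dots> \<le> card ?M + card ?L" by (rule card_Un_le)
  finally have "real (card {a \<in> A. \<exists>g \<in> T. (\<phi> g a = a) \<noteq> (g \<in> N)}) < \<epsilon> * real (card A)"
    using few_bad by linarith
  then have "stabilizer_model F N T \<epsilon> A \<phi>"
    using A \<phi>(1) by (simp add: stabilizer_model_def)
  then show ?thesis by blast
qed

text \<open>The trivial coset is represented by the identity because a sofic approximation has to send the
  identity exactly to the identity permutation.\<close>

lemma coset_representatives:
  assumes "N \<lhd> F"
  obtains t where "t N = \<one>\<^bsub>F\<^esub>"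
    "\<And>g. g \<in> carrier F \<Longrightarrow> t (N #>\<^bsub>F\<^esub> g) \<in> carrier F"
    "\<And>g. g \<in> carrier F \<Longrightarrow> N #>\<^bsub>F\<^esub> t (N #>\<^bsub>F\<^esub> g) = N #>\<^bsub>F\<^esub> g"
proof -
  interpret normal N F by (rule assms)
  define t where "t C = (if C = N then \<one>\<^bsub>F\<^esub> else SOME g. g \<in> carrier F \<and> C = N #>\<^bsub>F\<^esub> g)" for C
  have "t (N #>\<^bsub>F\<^esub> g) \<in> carrier F \<and> N #>\<^bsub>F\<^esub> t (N #>\<^bsub>F\<^esub> g) = N #>\<^bsub>F\<^esub> g"
    if "g \<in> carrier F" for g
  proof (cases "N #>\<^bsub>F\<^esub> g = N")
    case True
    then show ?thesis by (simp add: t_def coset_mult_one subset)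
  next
    case False
    have "\<exists>h. h \<in> carrier F \<and> N #>\<^bsub>F\<^esub> g = N #>\<^bsub>F\<^esub> h" using that by blast
    from someI_ex[OF this] show ?thesis using False by (simp add: t_def)
  qed
  then show thesis using that[of t] by (simp add: t_def)
qed

lemma (in normal) rcos_eq_iff:
  assumes "g \<in> carrier G" "h \<in> carrier G"
  shows "H #> g = H #> h \<longleftrightarrow> inv g \<otimes> h \<in> H"
proof -
  have "H #> g = H #> h \<longleftrightarrow> h \<in> H #> g"
    using assms by (metis is_subgroup rcos_self repr_independence)
  also have "\<dots> \<longleftrightarrow> h \<otimes> inv g \<in> H"
    using assms by (metis is_group rcos_module)
  also have "\<dots> \<longleftrightarrow> inv g \<otimes> h \<in> H"
  proof
    assume "h \<otimes> inv g \<in> H"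
    then have "inv g \<otimes> (h \<otimes> inv g) \<otimes> g \<in> H" using assms inv_op_closed1 by blast
    then show "inv g \<otimes> h \<in> H" using assms by (simp add: m_assoc)
  next
    assume "inv g \<otimes> h \<in> H"
    then have "g \<otimes> (inv g \<otimes> h) \<otimes> inv g \<in> H" using assms inv_op_closed2 by blast
    then show "h \<otimes> inv g \<in> H" using assms by (simp flip: m_assoc)
  qed
  finally show ?thesis .
qed

text \<open>Let \<open>C\<close> act as its representative \<open>t C\<close>. The defect \<open>u C D\<close> of multiplicativity lies in
  \<open>K\<close>, so it fixes almost every point, while the representative of a nontrivial coset lies outside
  \<open>K\<close> and moves almost every point.\<close>

lemma sofic_of_stabilizer_models:
  fixes F :: "('a, 'b) monoid_scheme"
  assumes K: "K \<lhd> F" and count: "countable (carrier F)"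
    and model: "\<And>T \<epsilon>. finite T \<Longrightarrow> T \<subseteq> carrier F \<Longrightarrow> 0 < \<epsilon> \<Longrightarrow>
      \<exists>(A :: 'c set) \<phi>. stabilizer_model F K T \<epsilon> A \<phi>"
  shows "sofic_group (F Mod K)"
  unfolding sofic_group_def
proof (intro conjI allI impI)
  interpret normal K F by (rule K)
  show G: "group (F Mod K)" by (rule factorgroup_is_group)
  show "countable (carrier (F Mod K))"
    using count by (simp add: carrier_FactGroup)
  fix S and \<epsilon> :: real
  assume "finite S \<and> S \<subseteq> carrier (F Mod K) \<and> 0 < \<epsilon>"
  then have S: "finite S" "S \<subseteq> carrier (F Mod K)" "0 < \<epsilon>" by auto
  obtain t where t1: "t K = \<one>\<^bsub>F\<^esub>"
    and t': "\<And>g. g \<in> carrier F \<Longrightarrow> t (K #>\<^bsub>F\<^esub> g) \<in> carrier F"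
      "\<And>g. g \<in> carrier F \<Longrightarrow> K #>\<^bsub>F\<^esub> t (K #>\<^bsub>F\<^esub> g) = K #>\<^bsub>F\<^esub> g"
    using coset_representatives[OF K] by blast
  have t: "t C \<in> carrier F" "K #>\<^bsub>F\<^esub> t C = C" if "C \<in> carrier (F Mod K)" for C
    using that t' by (auto simp: carrier_FactGroup)
  define u where "u C D = inv\<^bsub>F\<^esub> t (C <#>\<^bsub>F\<^esub> D) \<otimes>\<^bsub>F\<^esub> (t C \<otimes>\<^bsub>F\<^esub> t D)" for C D
  have CD: "C <#>\<^bsub>F\<^esub> D \<in> carrier (F Mod K)"
    if "C \<in> carrier (F Mod K)" "D \<in> carrier (F Mod K)" for C D
    using that group.is_monoid[OF G, THEN monoid.m_closed] by simp
  have u: "u C D \<in> carrier F" "u C D \<in> K"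
    if "C \<in> carrier (F Mod K)" "D \<in> carrier (F Mod K)" for C D
  proof -
    show "u C D \<in> carrier F" using t CD that by (simp add: u_def)
    have "K #>\<^bsub>F\<^esub> t (C <#>\<^bsub>F\<^esub> D) = K #>\<^bsub>F\<^esub> (t C \<otimes>\<^bsub>F\<^esub> t D)"
      using t(2)[OF CD[OF that]] t(2)[OF that(1)] t(2)[OF that(2)]
        rcos_sum[OF t(1)[OF that(1)] t(1)[OF that(2)]] by simp
    then show "u C D \<in> K" unfolding u_def
      using rcos_eq_iff[of "t (C <#>\<^bsub>F\<^esub> D)" "t C \<otimes>\<^bsub>F\<^esub> t D"] t(1)[OF CD[OF that]]
        t(1)[OF that(1)] t(1)[OF that(2)] by simp
  qed
  define T where "T = t ` S \<union> (\<lambda>(C, D). u C D) ` (S \<times> S)"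
  have "finite T" using S by (simp add: T_def)
  moreover have "T \<subseteq> carrier F"
  proof
    fix g assume "g \<in> T"
    then consider C where "C \<in> S" "g = t C" | C D where "C \<in> S" "D \<in> S" "g = u C D"
      by (auto simp: T_def)
    then show "g \<in> carrier F"
    proof cases
      case 1
      then show ?thesis using t(1) S(2) by (metis subsetD)
    next
      case 2
      then show ?thesis using u(1) S(2) by (metis subsetD)
    qed
  qed
  ultimately obtain A :: "'c set" and \<phi> where m: "stabilizer_model F K T \<epsilon> A \<phi>"
    using model S(3) by blast
  let ?B = "{a \<in> A. \<exists>g \<in> T. (\<phi> g a = a) \<noteq> (g \<in> K)}"
  have A: "finite A" "A \<noteq> {}" and \<phi>: "\<phi> \<in> hom F (symmetric_group A)"
    and bad: "real (card ?B) < \<epsilon> * real (card A)"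
    using m by (auto simp: stabilizer_model_def)
  have cA: "0 < card A" using A by (simp add: card_gt_0_iff)
  interpret perm_action F A \<phi> by unfold_locales (rule \<phi>)
  have "sofic_approximation (F Mod K) S \<epsilon> A (\<lambda>C. \<phi> (t C))"
    unfolding sofic_approximation_def
  proof (intro conjI ballI)
    show "\<phi> (t C) permutes A" if "C \<in> carrier (F Mod K)" for C
      using that t act_permutes by blast
    show "\<phi> (t \<one>\<^bsub>F Mod K\<^esub>) = id" by (auto simp: t1 act_one)
  next
    fix C D assume CDS: "C \<in> S" "D \<in> S"
    then have cc: "C \<in> carrier (F Mod K)" "D \<in> carrier (F Mod K)" using S by auto
    have uT: "u C D \<in> T" using CDS by (auto simp: T_def)
    have "{a \<in> A. \<phi> (t (C <#>\<^bsub>F\<^esub> D)) a \<noteq> (\<phi> (t C) \<circ> \<phi> (t D)) a} \<subseteq> ?B"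
    proof safe
      fix a assume a: "\<phi> (t (C <#>\<^bsub>F\<^esub> D)) a \<noteq> (\<phi> (t C) \<circ> \<phi> (t D)) a"
      then have "\<phi> (t (C <#>\<^bsub>F\<^esub> D)) a \<noteq> \<phi> (t C \<otimes>\<^bsub>F\<^esub> t D) a"
        using t cc by (simp add: act_mult)
      then have "\<phi> (u C D) a \<noteq> a"
        unfolding u_def using act_eq_iff t cc CD by (metis m_closed)
      then show "\<exists>g \<in> T. (\<phi> g a = a) \<noteq> (g \<in> K)" using uT u cc by blast
    qed
    then have "card {a \<in> A. \<phi> (t (C <#>\<^bsub>F\<^esub> D)) a \<noteq> (\<phi> (t C) \<circ> \<phi> (t D)) a} \<le> card ?B"
      using A by (intro card_mono) auto
    then have "real (card {a \<in> A. \<phi> (t (C <#>\<^bsub>F\<^esub> D)) a \<noteq> (\<phi> (t C) \<circ> \<phi> (t D)) a}) < \<epsilon> * real (card A)"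
      using bad by linarith
    then show "hamming_dist A (\<phi> (t (C \<otimes>\<^bsub>F Mod K\<^esub> D))) (\<phi> (t C) \<circ> \<phi> (t D)) < \<epsilon>"
      using cA by (simp add: hamming_dist_def field_simps)
  next
    fix C assume C: "C \<in> S - {\<one>\<^bsub>F Mod K\<^esub>}"
    then have cc: "C \<in> carrier (F Mod K)" using S by auto
    have "t C \<notin> K"
      using t[OF cc] C coset_join2 subgroup_axioms by fastforce
    moreover have "t C \<in> T" using C by (auto simp: T_def)
    ultimately have "A - {a \<in> A. \<phi> (t C) a \<noteq> a} \<subseteq> ?B" by blast
    then have "card (A - {a \<in> A. \<phi> (t C) a \<noteq> a}) \<le> card ?B"
      using A by (intro card_mono) auto
    moreover have "card (A - {a \<in> A. \<phi> (t C) a \<noteq> a}) = card A - card {a \<in> A. \<phi> (t C) a \<noteq> a}"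
      using A by (intro card_Diff_subset) auto
    ultimately have "real (card A) - real (card {a \<in> A. \<phi> (t C) a \<noteq> a}) < \<epsilon> * real (card A)"
      using bad by linarith
    then show "hamming_length A (\<phi> (t C)) > 1 - \<epsilon>"
      using cA by (simp add: hamming_length_def hamming_dist_def field_simps)
  qed
  moreover obtain f where f: "bij_betw f A {..<card A}"
    using ex_bij_betw_finite_nat[OF A(1)] by (auto simp: atLeast0LessThan)
  ultimately obtain \<tau> where "sofic_approximation (F Mod K) S \<epsilon> {..<card A} \<tau>"
    using sofic_approximation_transfer[OF G S(2)] by blast
  moreover have "finite {..<card A}" "{..<card A} \<noteq> {}" using cA by auto
  ultimately show "\<exists>(A :: nat set) \<sigma>. finite A \<and> A \<noteq> {} \<and> sofic_approximation (F Mod K) S \<epsilon> A \<sigma>"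
    by blast
qed


section \<open>The flow cocycle\<close>

text \<open>An edge \<open>(a, x)\<close> leads from \<open>a\<close> to \<open>\<phi> x a\<close>. The value \<open>c g a e\<close> is the signed number of times
  that the path of \<open>g\<close> starting at \<open>a\<close> crosses \<open>e\<close>; in a product the right factor is walked
  first.\<close>

locale flow_action = perm_action F A \<phi> for F (structure) and A :: "'c set" and \<phi> +
  fixes X :: "'a set" and c :: "'a \<Rightarrow> 'c \<Rightarrow> 'c \<times> 'a \<Rightarrow> int"
  assumes X_closed: "X \<subseteq> carrier F" and finite_A: "finite A" and finite_X: "finite X"
    and flow_mult: "g \<in> carrier F \<Longrightarrow> h \<in> carrier F \<Longrightarrow> c (g \<otimes> h) a e = c h a e + c g (\<phi> h a) e"
    and flow_gen: "x \<in> X \<Longrightarrow> c x a e = (if e = (a, x) then 1 else 0)"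
begin

lemma flow_one: "c \<one> a e = 0"
  using flow_mult[of \<one> \<one> a e] by (simp add: act_one)

lemma flow_inv: "g \<in> carrier F \<Longrightarrow> c (inv g) (\<phi> g a) e = - c g a e"
  using flow_mult[of "inv g" g a e] by (simp add: flow_one)

end

text \<open>Pairs of a permutation and a function, composed by the cocycle rule: a homomorphism into this
  group is the same thing as an action on \<open>A\<close> together with a cocycle. The functions are unrestricted
  off \<open>A\<close>, where the permutations are the identity, so the group laws hold at every point.\<close>

definition cocycle_group :: "'c set \<Rightarrow> (('c \<Rightarrow> 'c) \<times> ('c \<Rightarrow> 'e \<Rightarrow> int)) monoid" where
  "cocycle_group A = \<lparr>carrier = {p. p permutes A} \<times> UNIV,
     monoid.mult = (\<lambda>(p, c) (q, d). (p \<circ> q, \<lambda>a e. d a e + c (q a) e)),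
     one = (id, \<lambda>a e. 0)\<rparr>"

lemma group_cocycle_group: "group (cocycle_group A :: (('c \<Rightarrow> 'c) \<times> ('c \<Rightarrow> 'e \<Rightarrow> int)) monoid)"
proof (rule groupI)
  fix z :: "('c \<Rightarrow> 'c) \<times> ('c \<Rightarrow> 'e \<Rightarrow> int)" assume "z \<in> carrier (cocycle_group A)"
  then obtain p c where z: "z = (p, c)" and p: "p permutes A"
    by (auto simp: cocycle_group_def)
  let ?q = "inv_into UNIV p"
  have "(?q, \<lambda>a e. - c (?q a) e) \<in> carrier (cocycle_group A)"
    using p by (auto simp: cocycle_group_def permutes_inv)
  moreover have "(?q, \<lambda>a e. - c (?q a) e) \<otimes>\<^bsub>cocycle_group A\<^esub> z = \<one>\<^bsub>cocycle_group A\<^esub>"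
    using p by (simp add: z cocycle_group_def permutes_inv_o permutes_inverses)
  ultimately show "\<exists>y \<in> carrier (cocycle_group A). y \<otimes>\<^bsub>cocycle_group A\<^esub> z = \<one>\<^bsub>cocycle_group A\<^esub>"
    by blast
qed (auto simp: cocycle_group_def fun_eq_iff intro: permutes_compose permutes_id)

text \<open>By freeness the flow may be prescribed on the generators. The first component of the resulting
  homomorphism is the given action by uniqueness in the universal property.\<close>

lemma flow_cocycle_exists:
  assumes X: "free_basis F X" "finite X" and A: "finite A" and \<phi>: "\<phi> \<in> hom F (symmetric_group A)"
  shows "\<exists>c. flow_action F A \<phi> X c"
proof -
  interpret group F using X by (simp add: free_basis_def)
  interpret perm_action F A \<phi> by unfold_locales (rule \<phi>)
  have XF: "X \<subseteq> carrier F" using X by (simp add: free_basis_def)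
  let ?f = "\<lambda>x. (\<phi> x, \<lambda>a e. if e = (a, x) then 1 else 0 :: int)"
  have "?f \<in> X \<rightarrow> carrier (cocycle_group A)"
    using XF act_permutes by (auto simp: cocycle_group_def)
  then obtain h where h: "h \<in> hom F (cocycle_group A)" "\<And>x. x \<in> X \<Longrightarrow> h x = ?f x"
    using free_basis_universal[OF X(1) group_cocycle_group, of ?f A] by blast
  have mult: "h (g \<otimes>\<^bsub>F\<^esub> k) = h g \<otimes>\<^bsub>cocycle_group A\<^esub> h k"
    if "g \<in> carrier F" "k \<in> carrier F" for g k
    using hom_mult[OF h(1) that] .
  have "fst \<circ> h \<in> hom F (symmetric_group A)"
  proof (rule homI)
    show "(fst \<circ> h) g \<in> carrier (symmetric_group A)" if "g \<in> carrier F" for g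
      using hom_in_carrier[OF h(1) that] by (auto simp: cocycle_group_def)
    show "(fst \<circ> h) (g \<otimes>\<^bsub>F\<^esub> k) = (fst \<circ> h) g \<otimes>\<^bsub>symmetric_group A\<^esub> (fst \<circ> h) k"
      if "g \<in> carrier F" "k \<in> carrier F" for g k
      using mult[OF that] by (simp add: cocycle_group_def split: prod.splits)
  qed
  moreover have "\<phi> \<in> X \<rightarrow> carrier (symmetric_group A)"
    using XF act_permutes by auto
  moreover have "(fst \<circ> h) x = \<phi> x" if "x \<in> X" for x
    using h(2)[OF that] by simp
  ultimately have fst_h: "fst (h g) = \<phi> g" if "g \<in> carrier F" for g
    using free_basis_universal[OF X(1) group_symmetric_group, of \<phi> A] that \<phi>
    by (metis (no_types, lifting) comp_apply)
  have "flow_action F A \<phi> X (\<lambda>g. snd (h g))"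
  proof unfold_locales
    fix g k a e assume "g \<in> carrier F" "k \<in> carrier F"
    then show "snd (h (g \<otimes>\<^bsub>F\<^esub> k)) a e = snd (h k) a e + snd (h g) (\<phi> k a) e"
      using mult[of g k] fst_h[of k]
      by (cases "h g"; cases "h k") (simp add: cocycle_group_def)
  qed (use XF X A h in auto)
  then show ?thesis by blast
qed

section \<open>Vanishing flow characterizes the derived subgroup\<close>

lemma (in comm_group) finprod_int_pow_add:
  fixes f g :: "'i \<Rightarrow> int"
  assumes "k \<in> E \<rightarrow> carrier G"
  shows "(\<Otimes>e\<in>E. k e [^] (f e + g e)) = (\<Otimes>e\<in>E. k e [^] f e) \<otimes> (\<Otimes>e\<in>E. k e [^] g e)"
proof -
  have "(\<Otimes>e\<in>E. k e [^] (f e + g e)) = (\<Otimes>e\<in>E. k e [^] f e \<otimes> k e [^] g e)"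
    using assms by (intro finprod_cong) (auto simp: int_pow_mult Pi_iff)
  also have "\<dots> = (\<Otimes>e\<in>E. k e [^] f e) \<otimes> (\<Otimes>e\<in>E. k e [^] g e)"
    using assms by (intro finprod_multf) auto
  finally show ?thesis .
qed

lemma (in comm_group) finprod_int_pow_delta:
  assumes "k \<in> E \<rightarrow> carrier G" "finite E" "e0 \<in> E"
  shows "(\<Otimes>e\<in>E. k e [^] (if e = e0 then 1 else 0 :: int)) = k e0"
proof -
  have "(\<Otimes>e\<in>E. k e [^] (if e = e0 then 1 else 0 :: int)) = (\<Otimes>e\<in>E. if e0 = e then k e else \<one>)"
    using assms by (intro finprod_cong) (auto simp: Pi_iff simp_implies_def)
  also have "\<dots> = k e0" using assms by (intro finprod_singleton) auto
  finally show ?thesis .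
qed

text \<open>The setting for recovering an element of \<open>N\<close>, modulo the kernel of a homomorphism \<open>q\<close> to an
  abelian group, from its flow. The set \<open>V\<close> contains the vertices on the path considered, and
  \<open>V_inj\<close> says that distinct vertices of the Cayley graph of \<open>F / N\<close> in \<open>V\<close> stay
  distinct when the path is walked from \<open>a\<close>.\<close>

locale flow_transport = flow_action F A \<phi> X c + N: normal N F + K: comm_group K
  for F (structure) and A :: "'c set" and \<phi> X c N and K :: "('k, 'm) monoid_scheme" +
  fixes q :: "'a \<Rightarrow> 'k" and t :: "'a set \<Rightarrow> 'a" and V :: "'a set" and a :: 'c
  assumes q_hom: "q \<in> hom (F\<lparr>carrier := N\<rparr>) K"
    and t_N: "t N = \<one>" and t_closed: "g \<in> carrier F \<Longrightarrow> t (N #> g) \<in> carrier F"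
    and t_coset: "g \<in> carrier F \<Longrightarrow> N #> t (N #> g) = N #> g"
    and V_closed: "V \<subseteq> carrier F" and a_in: "a \<in> A"
    and V_inj: "u \<in> V \<Longrightarrow> v \<in> V \<Longrightarrow> \<phi> u a = \<phi> v a \<Longrightarrow> N #> u = N #> v"
begin

text \<open>The element of \<open>N\<close> obtained from the step \<open>v \<mapsto> g \<otimes> v\<close> by closing it up with the
  representatives of the cosets of its ends.\<close>

definition holonomy :: "'a \<Rightarrow> 'a \<Rightarrow> 'a" where
  "holonomy v g = inv t (N #> (g \<otimes> v)) \<otimes> g \<otimes> t (N #> v)"

text \<open>The holonomy along an edge of the action graph, transferred from the Cayley graph through the
  points of \<open>V\<close>. Edges that do not start in the image of \<open>V\<close> get the neutral label, so that products over
  all edges make sense.\<close>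

definition edge_label :: "'c \<times> 'a \<Rightarrow> 'k" where
  "edge_label e =
     (if \<exists>v \<in> V. \<phi> v a = fst e then q (holonomy (SOME v. v \<in> V \<and> \<phi> v a = fst e) (snd e)) else \<one>\<^bsub>K\<^esub>)"

text \<open>The invariant carried along a path: at the end of a path that is closed in the Cayley graph and
  has zero flow it reduces to the triviality of \<open>q g\<close>.\<close>

definition balanced :: "'a \<Rightarrow> bool" where
  "balanced g \<longleftrightarrow>
     q (inv t (N #> g) \<otimes> g) = finprod K (\<lambda>e. edge_label e [^]\<^bsub>K\<^esub> c g a e) (A \<times> X)"

lemma q_closed: "n \<in> N \<Longrightarrow> q n \<in> carrier K"
  using hom_in_carrier[OF q_hom] by simp

lemma q_mult: "m \<in> N \<Longrightarrow> n \<in> N \<Longrightarrow> q (m \<otimes> n) = q m \<otimes>\<^bsub>K\<^esub> q n"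
  using hom_mult[OF q_hom, of m n] by simp

lemma q_one: "q \<one> = \<one>\<^bsub>K\<^esub>"
proof -
  have "group (F\<lparr>carrier := N\<rparr>)"
    using N.subgroup_is_group is_group by blast
  then show ?thesis using hom_one[OF q_hom _ K.is_group] by simp
qed

lemma deviation_in_N: "g \<in> carrier F \<Longrightarrow> inv t (N #> g) \<otimes> g \<in> N"
  using t_closed t_coset N.rcos_eq_iff[of "t (N #> g)" g] by simp

lemma holonomy_in_N:
  assumes "v \<in> carrier F" "g \<in> carrier F"
  shows "holonomy v g \<in> N"
proof -
  have "N #> t (N #> (g \<otimes> v)) = N #> (g \<otimes> t (N #> v))"
    using assms t_closed t_coset N.rcos_sum by (metis m_closed)
  then show ?thesis
    using assms t_closed N.rcos_eq_iff[of "t (N #> (g \<otimes> v))" "g \<otimes> t (N #> v)"]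
    by (simp add: holonomy_def m_assoc)
qed

text \<open>The choice of \<open>v\<close> in the label is immaterial: by \<open>V_inj\<close> two choices lie in the same coset
  of \<open>N\<close>, and the holonomy depends on \<open>v\<close> only through its coset.\<close>

lemma edge_label_eq:
  assumes "v \<in> V" "x \<in> X"
  shows "edge_label (\<phi> v a, x) = q (holonomy v x)"
proof -
  have ex: "\<exists>u. u \<in> V \<and> \<phi> u a = \<phi> v a" using assms by blast
  define u where "u = (SOME u. u \<in> V \<and> \<phi> u a = \<phi> v a)"
  have u: "u \<in> V" "\<phi> u a = \<phi> v a" using someI_ex[OF ex] by (auto simp: u_def)
  then have c: "N #> u = N #> v" using V_inj assms by blast
  then have "N #> (x \<otimes> u) = N #> (x \<otimes> v)"
    using u assms V_closed X_closed N.rcos_sum by (metis subsetD)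
  then have "holonomy u x = holonomy v x" using c by (simp add: holonomy_def)
  moreover have "edge_label (\<phi> v a, x) = q (holonomy u x)"
    using assms by (auto simp: edge_label_def u_def)
  ultimately show ?thesis by simp
qed

lemma edge_label_closed: "edge_label \<in> A \<times> X \<rightarrow> carrier K"
proof
  fix e assume e: "e \<in> A \<times> X"
  show "edge_label e \<in> carrier K"
  proof (cases "\<exists>v \<in> V. \<phi> v a = fst e")
    case True
    then obtain v where "v \<in> V" "\<phi> v a = fst e" by blast
    then have "edge_label e = q (holonomy v (snd e))"
      using edge_label_eq[of v "snd e"] e by auto
    moreover have "holonomy v (snd e) \<in> N"
      using \<open>v \<in> V\<close> e V_closed X_closed by (intro holonomy_in_N) auto
    ultimately show ?thesis using q_closed by simp
  next
    case False
    then show ?thesis by (simp add: edge_label_def)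
  qed
qed

text \<open>Both sides of the balance change by the same factor, the label of the edge from
  \<open>\<phi> v a\<close>. Stated as an equivalence, this covers steps along \<open>x\<close> and against it.\<close>

lemma balanced_step:
  assumes v: "v \<in> V" and x: "x \<in> X"
  shows "balanced (x \<otimes> v) \<longleftrightarrow> balanced v"
proof -
  have cl: "v \<in> carrier F" "x \<in> carrier F" using v x V_closed X_closed by auto
  let ?P = "\<lambda>g. finprod K (\<lambda>e. edge_label e [^]\<^bsub>K\<^esub> c g a e) (A \<times> X)"
  let ?k = "edge_label (\<phi> v a, x)"
  have k: "?k = q (holonomy v x)" using v x by (rule edge_label_eq)
  have kc: "?k \<in> carrier K" using k holonomy_in_N cl q_closed by simp
  have Pc: "?P v \<in> carrier K" using edge_label_closed by (intro K.finprod_closed) auto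
  have "?P (x \<otimes> v) = ?P v \<otimes>\<^bsub>K\<^esub>
      finprod K (\<lambda>e. edge_label e [^]\<^bsub>K\<^esub> (if e = (\<phi> v a, x) then 1 else 0 :: int)) (A \<times> X)"
    using K.finprod_int_pow_add[OF edge_label_closed, of "c v a" "c x (\<phi> v a)"]
    by (simp add: flow_mult cl flow_gen x)
  also have "\<dots> = ?P v \<otimes>\<^bsub>K\<^esub> ?k"
    using K.finprod_int_pow_delta[OF edge_label_closed, of "(\<phi> v a, x)"]
      finite_A finite_X x act_in[OF cl(1) a_in] by simp
  finally have P: "?P (x \<otimes> v) = ?P v \<otimes>\<^bsub>K\<^esub> ?k" .
  have "inv t (N #> (x \<otimes> v)) \<otimes> (x \<otimes> v) = holonomy v x \<otimes> (inv t (N #> v) \<otimes> v)"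
  proof -
    have "t (N #> v) \<otimes> (inv t (N #> v) \<otimes> v) = v"
      using cl t_closed by (simp flip: m_assoc)
    then show ?thesis using cl t_closed by (simp add: holonomy_def m_assoc)
  qed
  then have "q (inv t (N #> (x \<otimes> v)) \<otimes> (x \<otimes> v)) = q (inv t (N #> v) \<otimes> v) \<otimes>\<^bsub>K\<^esub> ?k"
    using q_mult[OF holonomy_in_N deviation_in_N] cl k K.m_comm kc deviation_in_N q_closed by simp
  then show ?thesis
    unfolding balanced_def P using K.right_cancel kc Pc deviation_in_N cl q_closed by simp
qed

lemma balanced_word:
  assumes "w \<in> lists (UNIV \<times> X)" "path_vertices F w \<subseteq> V"
  shows "balanced (word_eval F (\<lambda>x. x) w)"
  using assms
proof (induction w)
  case Nil
  have "N #> \<one> = N" using N.subset by (rule coset_mult_one)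
  then show ?case
    by (simp add: balanced_def t_N q_one flow_one)
next
  case (Cons l w)
  obtain b x where l: "l = (b, x)" by fastforce
  let ?v = "word_eval F (\<lambda>x. x) w" and ?u = "word_eval F (\<lambda>x. x) (l # w)"
  have x: "x \<in> X" "x \<in> carrier F" using Cons.hyps l X_closed by auto
  have v: "?v \<in> V" "?u \<in> V" "balanced ?v"
    using Cons word_eval_in_path_vertices[of F w] by auto
  have vc: "?v \<in> carrier F" using v V_closed by auto
  show ?case
  proof (cases b)
    case True
    then show ?thesis using balanced_step[OF v(1) x(1)] v(3) l by simp
  next
    case False
    then have "x \<otimes> ?u = ?v" using l x vc by (simp flip: m_assoc)
    then show ?thesis using balanced_step[OF v(2) x(1)] v(3) by simp
  qed
qed

lemma trivial_of_zero_flow: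
  assumes "w \<in> lists (UNIV \<times> X)" "path_vertices F w \<subseteq> V"
    and g: "g = word_eval F (\<lambda>x. x) w" "g \<in> N" and zero: "\<And>e. e \<in> A \<times> X \<Longrightarrow> c g a e = 0"
  shows "q g = \<one>\<^bsub>K\<^esub>"
proof -
  have "N #> g = N" using g(2) by (simp add: N.rcos_const)
  then have "q g = finprod K (\<lambda>e. edge_label e [^]\<^bsub>K\<^esub> c g a e) (A \<times> X)"
    using balanced_word[OF assms(1,2)] g N.mem_carrier[OF g(2)] by (simp add: balanced_def t_N)
  also have "\<dots> = \<one>\<^bsub>K\<^esub>"
    using zero by (intro K.finprod_one_eqI) simp
  finally show ?thesis .
qed

end

text \<open>On the stabilizer of a point the cocycle is a homomorphism to the integers, which are abelian.\<close>

lemma (in flow_action) zero_flow_commutator: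
  assumes g: "g \<in> carrier F" "\<phi> g a = a" and h: "h \<in> carrier F" "\<phi> h a = a"
  shows "\<phi> (g \<otimes> h \<otimes> inv g \<otimes> inv h) a = a" "c (g \<otimes> h \<otimes> inv g \<otimes> inv h) a e = 0"
proof -
  have "\<phi> (inv g) a = a" "\<phi> (inv h) a = a"
    using act_inv[of g a] act_inv[of h a] g h by simp_all
  moreover have "c (inv g) a e = - c g a e" "c (inv h) a e = - c h a e"
    using flow_inv[of g a e] flow_inv[of h a e] g h by simp_all
  ultimately show "\<phi> (g \<otimes> h \<otimes> inv g \<otimes> inv h) a = a" "c (g \<otimes> h \<otimes> inv g \<otimes> inv h) a e = 0"
    using g h by (simp_all add: act_mult flow_mult)
qed

lemma (in flow_action) zero_flow_on_derived:
  assumes M: "M \<subseteq> carrier F" "\<And>u. u \<in> M \<Longrightarrow> \<phi> u a = a" and g: "g \<in> derived F M"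
  shows "\<phi> g a = a \<and> c g a e = 0"
proof -
  have gen: "\<phi> h a = a \<and> c h a e = 0" if h: "h \<in> derived_set F M" for h
  proof -
    obtain m n where mn: "m \<in> M" "n \<in> M" "h = m \<otimes> n \<otimes> inv m \<otimes> inv n"
      using h by auto
    then show ?thesis
      using zero_flow_commutator(1)[of m a n] zero_flow_commutator(2)[of m a n e] M by auto
  qed
  show ?thesis
    using g unfolding derived_def
  proof (induction rule: generate.induct)
    case one
    show ?case by (simp add: act_one flow_one)
  next
    case (incl g)
    then show ?case by (rule gen)
  next
    case (inv g)
    have "g \<in> carrier F" using inv derived_set_in_carrier[OF M(1)] by blast
    moreover have "\<phi> g a = a" "c g a e = 0"
      using inv gen by blast+
    ultimately show ?case
      using act_inv[of g a] flow_inv[of g a e] by simp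
  next
    case (eng g h)
    have "g \<in> carrier F" "h \<in> carrier F"
      using eng.hyps derived_in_carrier[OF M(1)] by (auto simp: derived_def)
    then show ?case using eng.IH by (simp add: act_mult flow_mult)
  qed
qed

text \<open>This makes membership in the derived subgroup a local condition: only the finitely many elements
  of \<open>M\<close> have to fix the point at which the flow is measured.\<close>

lemma (in group) derived_finite_support:
  assumes "g \<in> derived G N"
  shows "\<exists>M. finite M \<and> M \<subseteq> N \<and> g \<in> derived G M"
  using assms unfolding derived_def
proof (induction rule: generate.induct)
  case one
  have "\<one> \<in> generate G (derived_set G {})" by (rule generate.one)
  then show ?case by blast
next
  case (incl g)
  then obtain m n where mn: "m \<in> N" "n \<in> N" "g \<in> derived_set G {m, n}" by auto
  then have "g \<in> generate G (derived_set G {m, n})" by (intro generate.incl)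
  then show ?case using mn by (intro exI[of _ "{m, n}"]) simp
next
  case (inv g)
  then obtain m n where mn: "m \<in> N" "n \<in> N" "g \<in> derived_set G {m, n}" by auto
  then have "inv g \<in> generate G (derived_set G {m, n})" by (intro generate.inv)
  then show ?case using mn by (intro exI[of _ "{m, n}"]) simp
next
  case (eng g h)
  then obtain M L where fin: "finite M" "M \<subseteq> N" "g \<in> derived G M" "finite L" "L \<subseteq> N" "h \<in> derived G L"
    by (auto simp: derived_def)
  then have "g \<in> derived G (M \<union> L)" "h \<in> derived G (M \<union> L)"
    using mono_derived[of M "M \<union> L"] mono_derived[of L "M \<union> L"] by auto
  then have "g \<otimes> h \<in> derived G (M \<union> L)"
    unfolding derived_def by (rule generate.eng)
  then show ?case using fin by (intro exI[of _ "M \<union> L"]) (simp add: derived_def)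
qed

text \<open>The finite set \<open>U\<close> says how far the graph around \<open>a\<close> has to resemble the Cayley graph. It is
  chosen before the action and serves all actions at once. For \<open>g\<close> in the derived subgroup it consists of the
  elements whose commutators produce \<open>g\<close>; otherwise it consists of \<open>g\<close> and the quotients
  \<open>u\<inverse> v\<close> of vertices on the path of a word for \<open>g\<close>, which makes the path in \<open>A\<close> distinguish all
  vertices that the Cayley graph distinguishes.\<close>

lemma derived_local_criterion:
  assumes X: "free_basis F X" and N: "N \<lhd> F" and g: "g \<in> carrier F"
  shows "\<exists>U. finite U \<and> U \<subseteq> carrier F \<and> (\<forall>(A :: 'c set) \<phi> c a. flow_action F A \<phi> X c \<longrightarrow> a \<in> A \<longrightarrow>
    (\<forall>u \<in> U. \<phi> u a = a \<longleftrightarrow> u \<in> N) \<longrightarrow>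
    (\<phi> g a = a \<and> (\<forall>e \<in> A \<times> X. c g a e = 0) \<longleftrightarrow> g \<in> derived F N))"
proof (cases "g \<in> derived F N")
  case True
  interpret normal N F by (rule N)
  obtain U where U: "finite U" "U \<subseteq> N" "g \<in> derived F U"
    using derived_finite_support[OF True] by blast
  have "\<phi> g a = a \<and> (\<forall>e \<in> A \<times> X. c g a e = 0)"
    if f: "flow_action F A \<phi> X c" and u: "\<forall>u \<in> U. \<phi> u a = a \<longleftrightarrow> u \<in> N"
    for A :: "'c set" and \<phi> c a
  proof -
    interpret flow_action F A \<phi> X c by (rule f)
    have "U \<subseteq> carrier F" using U(2) subset by blast
    moreover have "\<phi> v a = a" if "v \<in> U" for v using u U(2) that by blast
    ultimately show ?thesis using zero_flow_on_derived U(3) by blast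
  qed
  then show ?thesis using True U(1,2) subset by (intro exI[of _ U]) blast
next
  case False
  interpret normal N F by (rule N)
  let ?Q = "F\<lparr>carrier := N\<rparr> Mod derived F N"
  interpret D: normal "derived F N" "F\<lparr>carrier := N\<rparr>"
    by (rule derived_subgroup_is_normal[OF subgroup_axioms])
  have Q: "comm_group ?Q"
    by (rule derived_quot_of_subgroup_is_comm_group[OF subgroup_axioms])
  define q where "q n = derived F N #>\<^bsub>F\<lparr>carrier := N\<rparr>\<^esub> n" for n
  have q: "q \<in> hom (F\<lparr>carrier := N\<rparr>) ?Q"
    using D.r_coset_hom_Mod by (simp add: q_def[abs_def])
  obtain t where t: "t N = \<one>\<^bsub>F\<^esub>"
    "\<And>g. g \<in> carrier F \<Longrightarrow> t (N #>\<^bsub>F\<^esub> g) \<in> carrier F"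
    "\<And>g. g \<in> carrier F \<Longrightarrow> N #>\<^bsub>F\<^esub> t (N #>\<^bsub>F\<^esub> g) = N #>\<^bsub>F\<^esub> g"
    using coset_representatives[OF N] by blast
  obtain w where w: "w \<in> lists (UNIV \<times> X)" "word_eval F (\<lambda>x. x) w = g"
    using free_basis_word[OF X g] by blast
  have XF: "X \<subseteq> carrier F" using X by (simp add: free_basis_def)
  define V where "V = path_vertices F w"
  have V: "finite V" "V \<subseteq> carrier F"
    using finite_path_vertices path_vertices_closed[OF XF w(1)] by (auto simp: V_def)
  define U where "U = insert g ((\<lambda>(u, v). inv\<^bsub>F\<^esub> u \<otimes>\<^bsub>F\<^esub> v) ` (V \<times> V))"
  have U: "finite U" "U \<subseteq> carrier F" using V g by (auto simp: U_def)
  have "\<not> (\<phi> g a = a \<and> (\<forall>e \<in> A \<times> X. c g a e = 0))"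
    if f: "flow_action F A \<phi> X c" and a: "a \<in> A" and u: "\<forall>u \<in> U. \<phi> u a = a \<longleftrightarrow> u \<in> N"
    for A :: "'c set" and \<phi> c a
  proof
    assume zero: "\<phi> g a = a \<and> (\<forall>e \<in> A \<times> X. c g a e = 0)"
    then have gN: "g \<in> N" using u by (simp add: U_def)
    interpret flow_action F A \<phi> X c by (rule f)
    interpret Q: comm_group ?Q by (rule Q)
    have inj: "N #>\<^bsub>F\<^esub> u = N #>\<^bsub>F\<^esub> v" if "u \<in> V" "v \<in> V" "\<phi> u a = \<phi> v a" for u v
    proof -
      have uv: "u \<in> carrier F" "v \<in> carrier F" using that V by auto
      then have "\<phi> (inv\<^bsub>F\<^esub> u \<otimes>\<^bsub>F\<^esub> v) a = a" using act_eq_iff that(3) by blast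
      moreover have "inv\<^bsub>F\<^esub> u \<otimes>\<^bsub>F\<^esub> v \<in> U" using that by (auto simp: U_def)
      ultimately show ?thesis using rcos_eq_iff uv u by blast
    qed
    interpret flow_transport F A \<phi> X c N ?Q q t V a
      by (intro flow_transport.intro flow_transport_axioms.intro)
        (fact f N Q q t V(2) a inj)+
    have "q g = derived F N"
      using trivial_of_zero_flow[OF w(1) _ w(2)[symmetric] gN] zero by (simp add: V_def)
    then have "g \<in> derived F N"
      using D.rcos_self[of g] gN D.subgroup_axioms by (auto simp: q_def)
    then show False using False by simp
  qed
  then show ?thesis using False U by (intro exI[of _ U]) blast
qed

section \<open>The finite cover carrying the flow\<close>

context flow_action
begin

text \<open>The group of integers modulo \<open>m\<close> is represented by \<open>{0..<m}\<close>, and functions on the edges are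
  extensional to keep the cover finite.\<close>

definition cover :: "int \<Rightarrow> ('c \<times> ('c \<times> 'a \<Rightarrow> int)) set" where
  "cover m = A \<times> (A \<times> X \<rightarrow>\<^sub>E {0..<m})"

definition cover_act ::
    "int \<Rightarrow> 'a \<Rightarrow> 'c \<times> ('c \<times> 'a \<Rightarrow> int) \<Rightarrow> 'c \<times> ('c \<times> 'a \<Rightarrow> int)" where
  "cover_act m g p = (if p \<in> cover m
     then (\<phi> g (fst p), \<lambda>e \<in> A \<times> X. (snd p e + c g (fst p) e) mod m) else p)"

lemma finite_cover: "finite (cover m)"
  using finite_A finite_X by (auto simp: cover_def intro!: finite_PiE)

lemma card_cover_over:
  assumes "B \<subseteq> A"
  shows "card {p \<in> cover m. fst p \<in> B} = card B * card (A \<times> X \<rightarrow>\<^sub>E {0..<m})"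
proof -
  have "{p \<in> cover m. fst p \<in> B} = B \<times> (A \<times> X \<rightarrow>\<^sub>E {0..<m})"
    using assms by (auto simp: cover_def)
  then show ?thesis by (simp add: card_cartesian_product)
qed

lemma cover_act_in:
  assumes "0 < m" "g \<in> carrier F" "p \<in> cover m"
  shows "cover_act m g p \<in> cover m"
  using assms act_in by (auto simp: cover_act_def cover_def)

lemma cover_act_mult:
  assumes "0 < m" "g \<in> carrier F" "h \<in> carrier F"
  shows "cover_act m (g \<otimes> h) p = cover_act m g (cover_act m h p)"
proof (cases "p \<in> cover m")
  case True
  then show ?thesis
    using cover_act_in[OF assms(1,3) True] assms
    by (auto simp: cover_act_def act_mult flow_mult mod_simps add_ac intro!: restrict_ext)
next
  case False
  then show ?thesis by (simp add: cover_act_def)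
qed

lemma cover_act_one: "cover_act m \<one> p = p"
proof (cases "p \<in> cover m")
  case True
  then obtain a f where p: "p = (a, f)" "f \<in> A \<times> X \<rightarrow>\<^sub>E {0..<m}" by (auto simp: cover_def)
  have "(\<lambda>e \<in> A \<times> X. f e mod m) = restrict f (A \<times> X)"
    using p(2) by (intro restrict_ext) (auto simp: PiE_iff)
  also have "\<dots> = f" using p(2) by (simp add: PiE_restrict)
  finally show ?thesis using True p by (simp add: cover_act_def act_one flow_one)
qed (simp add: cover_act_def)

lemma cover_act_hom:
  assumes "0 < m"
  shows "cover_act m \<in> hom F (symmetric_group (cover m))"
proof (rule homI)
  fix g assume g: "g \<in> carrier F"
  have "cover_act m (inv g) (cover_act m g p) = p" "cover_act m g (cover_act m (inv g) p) = p" for p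
    using cover_act_mult[OF assms, of "inv g" g p] cover_act_mult[OF assms, of g "inv g" p] g
    by (simp_all add: cover_act_one)
  then have "bij_betw (cover_act m g) (cover m) (cover m)"
    using cover_act_in[OF assms] g
    by (intro bij_betw_byWitness[where f' = "cover_act m (inv g)"]) auto
  then show "cover_act m g \<in> carrier (symmetric_group (cover m))"
    by (simp add: bij_imp_permutes cover_act_def)
qed (use cover_act_mult[OF assms] in auto)

text \<open>The bound on the flow ensures that it vanishes as soon as it vanishes modulo \<open>m\<close>.\<close>

lemma cover_act_fixed_iff:
  assumes "p \<in> cover m" and small: "\<And>e. e \<in> A \<times> X \<Longrightarrow> \<bar>c g (fst p) e\<bar> < m"
  shows "cover_act m g p = p \<longleftrightarrow> \<phi> g (fst p) = fst p \<and> (\<forall>e \<in> A \<times> X. c g (fst p) e = 0)"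
proof -
  obtain a f where p: "p = (a, f)" "f \<in> A \<times> X \<rightarrow>\<^sub>E {0..<m}"
    using assms(1) by (auto simp: cover_def)
  have "(\<lambda>e \<in> A \<times> X. (f e + c g a e) mod m) = f \<longleftrightarrow>
      (\<forall>e \<in> A \<times> X. (f e + c g a e) mod m = f e)"
    using p(2) by (auto simp: fun_eq_iff restrict_def PiE_iff extensional_def)
  also have "\<dots> \<longleftrightarrow> (\<forall>e \<in> A \<times> X. c g a e = 0)"
  proof (rule ball_cong[OF refl])
    fix e assume e: "e \<in> A \<times> X"
    then have f: "f e mod m = f e" using p(2) by (auto simp: PiE_iff)
    have "(f e + c g a e) mod m = f e \<longleftrightarrow> m dvd c g a e"
      using f mod_eq_dvd_iff[of "f e + c g a e" m "f e"] by simp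
    also have "\<dots> \<longleftrightarrow> c g a e = 0"
      using small[OF e] p(1) dvd_imp_le_int[of "c g a e" m] by auto
    finally show "(f e + c g a e) mod m = f e \<longleftrightarrow> c g a e = 0" .
  qed
  finally show ?thesis using assms(1) p(1) by (simp add: cover_act_def)
qed

end

text \<open>Bad points of the cover lie over bad points of \<open>A\<close>, and all fibers have the same size, so the
  bound \<open>\<epsilon>\<close> carries over unchanged.\<close>

lemma stabilizer_model_derived:
  fixes F :: "('a, 'b) monoid_scheme"
  assumes X: "free_basis F X" "finite X" and N: "N \<lhd> F"
    and model: "\<And>T \<epsilon>. finite T \<Longrightarrow> T \<subseteq> carrier F \<Longrightarrow> 0 < \<epsilon> \<Longrightarrow>
      \<exists>(A :: 'c set) \<phi>. stabilizer_model F N T \<epsilon> A \<phi>"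
    and T: "finite T" "T \<subseteq> carrier F" "0 < \<epsilon>"
  shows "\<exists>(B :: ('c \<times> ('c \<times> 'a \<Rightarrow> int)) set) \<theta>. stabilizer_model F (derived F N) T \<epsilon> B \<theta>"
proof -
  define detects where "detects g U \<longleftrightarrow>
    (\<forall>(A :: 'c set) \<phi> c a. flow_action F A \<phi> X c \<longrightarrow> a \<in> A \<longrightarrow>
      (\<forall>u \<in> U. \<phi> u a = a \<longleftrightarrow> u \<in> N) \<longrightarrow>
      (\<phi> g a = a \<and> (\<forall>e \<in> A \<times> X. c g a e = 0) \<longleftrightarrow> g \<in> derived F N))" for g U
  have "\<exists>U. finite U \<and> U \<subseteq> carrier F \<and> detects g U" if "g \<in> T" for g
    unfolding detects_def using that T(2) by (intro derived_local_criterion[OF X(1) N]) auto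
  then obtain U where
    U: "\<And>g. g \<in> T \<Longrightarrow> finite (U g) \<and> U g \<subseteq> carrier F" "\<And>g. g \<in> T \<Longrightarrow> detects g (U g)"
    by metis
  have crit: "\<phi> g a = a \<and> (\<forall>e \<in> A \<times> X. c g a e = 0) \<longleftrightarrow> g \<in> derived F N"
    if "g \<in> T" "flow_action F A \<phi> X c" "a \<in> A" "\<forall>u \<in> U g. \<phi> u a = a \<longleftrightarrow> u \<in> N"
    for g and A :: "'c set" and \<phi> c a
    using U(2)[OF that(1), unfolded detects_def, rule_format, OF that(2,3)] that(4) by simp
  define W where "W = (\<Union>g \<in> T. U g)"
  have "finite W" "W \<subseteq> carrier F" using U(1) T by (auto simp: W_def)
  then obtain A :: "'c set" and \<phi> where m: "stabilizer_model F N W \<epsilon> A \<phi>"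
    using model T(3) by blast
  have A: "finite A" "A \<noteq> {}" and \<phi>: "\<phi> \<in> hom F (symmetric_group A)"
    and bad: "real (card {a \<in> A. \<exists>g \<in> W. (\<phi> g a = a) \<noteq> (g \<in> N)}) < \<epsilon> * real (card A)"
    using m by (auto simp: stabilizer_model_def)
  obtain c where "flow_action F A \<phi> X c"
    using flow_cocycle_exists[OF X A(1) \<phi>] by blast
  then interpret flow_action F A \<phi> X c .
  \<comment> \<open>The modulus only has to exceed the finitely many flow values that occur, so it may be chosen
    after the action.\<close>
  define m where "m = 1 + (\<Sum>(g, a, e) \<in> T \<times> A \<times> A \<times> X. \<bar>c g a e\<bar>)"
  have small: "\<bar>c g a e\<bar> < m" if "g \<in> T" "a \<in> A" "e \<in> A \<times> X" for g a e
    using member_le_sum[of "(g, a, e)" "T \<times> A \<times> A \<times> X" "\<lambda>(g, a, e). \<bar>c g a e\<bar>"] that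
      T(1) finite_A finite_X by (auto simp: m_def)
  have "0 < m" by (auto simp: m_def intro!: add_pos_nonneg sum_nonneg)
  let ?B = "{a \<in> A. \<exists>g \<in> W. (\<phi> g a = a) \<noteq> (g \<in> N)}" and ?M = "A \<times> X \<rightarrow>\<^sub>E {0..<m}"
  have M: "finite ?M" "?M \<noteq> {}"
    using finite_A finite_X \<open>0 < m\<close> by (auto intro!: finite_PiE simp: PiE_eq_empty_iff)
  have "{p \<in> cover m. \<exists>g \<in> T. (cover_act m g p = p) \<noteq> (g \<in> derived F N)}
      \<subseteq> {p \<in> cover m. fst p \<in> ?B}"
  proof
    fix p assume "p \<in> {p \<in> cover m. \<exists>g \<in> T. (cover_act m g p = p) \<noteq> (g \<in> derived F N)}"
    then obtain g where p: "p \<in> cover m" and g: "g \<in> T"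
      and ne: "(cover_act m g p = p) \<noteq> (g \<in> derived F N)" by blast
    have a: "fst p \<in> A" using p by (auto simp: cover_def)
    have "\<not> (\<forall>u \<in> U g. \<phi> u (fst p) = fst p \<longleftrightarrow> u \<in> N)"
      using crit[OF g flow_action_axioms a] cover_act_fixed_iff[OF p small[OF g a]] ne by blast
    then show "p \<in> {p \<in> cover m. fst p \<in> ?B}"
      using a g p by (auto simp: W_def)
  qed
  then have "card {p \<in> cover m. \<exists>g \<in> T. (cover_act m g p = p) \<noteq> (g \<in> derived F N)}
      \<le> card {p \<in> cover m. fst p \<in> ?B}"
    using finite_cover by (intro card_mono) auto
  also have "\<dots> = card ?B * card ?M" by (intro card_cover_over) auto
  finally have "real (card {p \<in> cover m. \<exists>g \<in> T. (cover_act m g p = p) \<noteq> (g \<in> derived F N)})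
      \<le> real (card ?B) * real (card ?M)"
    by (simp only: of_nat_mult[symmetric] of_nat_le_iff)
  also have "\<dots> < \<epsilon> * real (card A) * real (card ?M)"
    using bad M by (intro mult_strict_right_mono) (auto simp: card_gt_0_iff)
  also have "\<dots> = \<epsilon> * real (card (cover m))"
    by (simp add: cover_def card_cartesian_product)
  finally have "stabilizer_model F (derived F N) T \<epsilon> (cover m) (cover_act m)"
    using finite_cover cover_act_hom[OF \<open>0 < m\<close>] A M
    by (simp add: stabilizer_model_def cover_def)
  then show ?thesis by blast
qed

section \<open>Soficity of the quotient by the derived subgroup\<close>

theorem corollary2:
  fixes F :: "('a, 'b) monoid_scheme" and N :: "'a set"
  assumes "finite_rank_free_group F"
    and "N \<lhd> F"
    and "sofic_group (F Mod N)"
  shows "sofic_group (F Mod derived F N)"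
proof -
  obtain X where X: "finite X" "free_basis F X"
    using assms(1) by (auto simp: finite_rank_free_group_def)
  interpret group F using X(2) by (simp add: free_basis_def)
  show ?thesis
  proof (rule sofic_of_stabilizer_models[OF derived_is_normal[OF assms(2)] countable_free_group[OF X(2,1)]])
    show "\<exists>(B :: (nat \<times> (nat \<times> 'a \<Rightarrow> int)) set) \<theta>. stabilizer_model F (derived F N) T \<epsilon> B \<theta>"
      if "finite T" "T \<subseteq> carrier F" "0 < \<epsilon>" for T \<epsilon>
      by (rule stabilizer_model_derived[OF X(2,1) assms(2) stabilizer_model_of_sofic[OF X(2) assms(2,3)] that])
  qed
qed

end
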